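(* If $M\subset\mathbb{C}^n$ is a closed set which admits Carleman approximation by entire functions, then $M$ has bounded E-hulls.
   Context: Carleman approximation: a closed set $M\subset\mathbb{C}^n$ admits Carleman approximation by entire functions if $\mathcal{O}(\mathbb{C}^n)$ is dense in $\mathcal{C}(M)$ (continuous complex-valued functions) in the Whitney $\mathcal{C}^0$-topology, i.e. for every $f\in\mathcal{C}(M)$ and every continuous $\epsilon:M\to(0,\infty)$ there is an entire function $g\in\mathcal{O}(\mathbb{C}^n)$ with $|g(x)-f(x)|<\epsilon(x)$ for all $x\in M$. Hulls: for a compact set $X$, $\widehat X$ is the usual polynomially convex hull. For a closed set $X\subset\mathbb{C}^n$ with a compact normal exhaustion $X_j$ (compact sets with union $X$, each $X_j$ contained in the interior of $X_{j+1}$ relative to $X$), define $\widehat X:=\bigcup_j\widehat{X_j}$; this is independent of the exhaustion. Set $h(X):=\widehat X\setminus X$. Bounded E-hulls: a closed set $M\subset\mathbb{C}^n$ has bounded E-hulls if for every compact set $K\subset\mathbb{C}^n$ the set $h(K\cup M)$ is bounded. *)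

theory Defs
  imports "HOL-Analysis.Analysis"
begin

section \<open>Entire functions and polynomials on complex n-space\<close>

text \<open>
  Complex n-space is \<^typ>\<open>complex ^ 'n\<close>. A function is entire if it is complex differentiable
  everywhere, that is, if at every point it has a Frechet derivative that is complex linear;
  additivity of \<open>D\<close> is part of \<^const>\<open>has_derivative\<close>.
\<close>

definition entire :: "(complex ^ 'n \<Rightarrow> complex) \<Rightarrow> bool" where
  "entire f \<longleftrightarrow>
     (\<forall>z. \<exists>D. (f has_derivative D) (at z) \<and> (\<forall>c v. D (c *s v) = c * D v))"

definition complex_polynomial :: "(complex ^ 'n \<Rightarrow> complex) \<Rightarrow> bool" where
  "complex_polynomial p \<longleftrightarrow>
     (\<exists>(A :: ('n \<Rightarrow> nat) set) c. finite A \<and>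
        p = (\<lambda>z. \<Sum>\<alpha>\<in>A. c \<alpha> * (\<Prod>i\<in>UNIV. (z $ i) ^ \<alpha> i)))"

section \<open>Carleman approximation\<close>

definition carleman_approximation :: "(complex ^ 'n) set \<Rightarrow> bool" where
  "carleman_approximation M \<longleftrightarrow>
     (\<forall>(f :: complex ^ 'n \<Rightarrow> complex) (\<epsilon> :: complex ^ 'n \<Rightarrow> real).
        continuous_on M f \<and> continuous_on M \<epsilon> \<and> (\<forall>x\<in>M. 0 < \<epsilon> x) \<longrightarrow>
        (\<exists>g. entire g \<and> (\<forall>x\<in>M. norm (g x - f x) < \<epsilon> x)))"

section \<open>Hulls\<close>

text \<open>
  The guard \<open>X \<noteq> {}\<close> is there because the supremum of the empty set of reals is unspecified;
  the hull of the empty set is empty. This definition is intended for compact \<open>X\<close>.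
\<close>

definition poly_hull :: "(complex ^ 'n) set \<Rightarrow> (complex ^ 'n) set" where
  "poly_hull X =
     {z. X \<noteq> {} \<and> (\<forall>p. complex_polynomial p \<longrightarrow> norm (p z) \<le> (SUP x\<in>X. norm (p x)))}"

definition normal_exhaustion :: "(nat \<Rightarrow> 'a::topological_space set) \<Rightarrow> 'a set \<Rightarrow> bool" where
  "normal_exhaustion E X \<longleftrightarrow>
     (\<forall>j. compact (E j)) \<and> (\<Union>j. E j) = X \<and>
     (\<forall>j. E j \<subseteq> (top_of_set X) interior_of (E (Suc j)))"

text \<open>
  The hull of a closed set is computed from some normal exhaustion; the lemmas
  \<open>normal_exhaustion_exists\<close> and \<open>closed_hull_eq\<close> below show that one exists and that the
  choice does not matter, and \<open>closed_hull_compact\<close> that nothing new is defined for compact sets.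
\<close>

definition closed_hull :: "(complex ^ 'n) set \<Rightarrow> (complex ^ 'n) set" where
  "closed_hull X = (\<Union>j. poly_hull ((SOME E. normal_exhaustion E X) j))"

definition hull_excess :: "(complex ^ 'n) set \<Rightarrow> (complex ^ 'n) set" where
  "hull_excess X = closed_hull X - X"

definition bounded_E_hulls :: "(complex ^ 'n) set \<Rightarrow> bool" where
  "bounded_E_hulls M \<longleftrightarrow> (\<forall>K. compact K \<longrightarrow> bounded (hull_excess (K \<union> M)))"

lemma normal_exhaustion_exists:
  fixes X :: "'a::euclidean_space set"
  assumes "closed X"
  shows "\<exists>E. normal_exhaustion E X"
proof (intro exI)
  let ?E = "\<lambda>j::nat. X \<inter> cball 0 (real j)"
  have "?E j \<subseteq> (top_of_set X) interior_of (?E (Suc j))" for j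
  proof -
    have "openin (top_of_set X) (X \<inter> ball 0 (real (Suc j)))"
      by (simp add: openin_open_Int)
    moreover have "X \<inter> ball 0 (real (Suc j)) \<subseteq> ?E (Suc j)"
      by auto
    ultimately have "X \<inter> ball 0 (real (Suc j)) \<subseteq> (top_of_set X) interior_of (?E (Suc j))"
      by (rule interior_of_maximal[rotated])
    moreover have "?E j \<subseteq> X \<inter> ball 0 (real (Suc j))"
      by auto
    ultimately show ?thesis by blast
  qed
  moreover have "(\<Union>j. ?E j) = X"
    by (auto intro: real_arch_simple)
  ultimately show "normal_exhaustion ?E X"
    using assms by (simp add: normal_exhaustion_def closed_Int_compact)
qed

lemma complex_polynomial_continuous:
  assumes "complex_polynomial p"
  shows "continuous_on S p"
  using assms unfolding complex_polynomial_def by (auto intro!: continuous_intros)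

lemma poly_hull_mono:
  fixes X Y :: "(complex ^ 'n) set"
  assumes "X \<subseteq> Y" "compact Y"
  shows "poly_hull X \<subseteq> poly_hull Y"
proof
  fix z assume z: "z \<in> poly_hull X"
  then have ne: "X \<noteq> {}" by (simp add: poly_hull_def)
  have "norm (p z) \<le> (SUP x\<in>Y. norm (p x))" if p: "complex_polynomial p" for p
  proof -
    have "compact ((\<lambda>x. norm (p x)) ` Y)"
      using complex_polynomial_continuous[OF p] assms(2)
      by (intro compact_continuous_image continuous_on_norm)
    then have "bdd_above ((\<lambda>x. norm (p x)) ` Y)"
      by (intro bounded_imp_bdd_above compact_imp_bounded)
    then have "(SUP x\<in>X. norm (p x)) \<le> (SUP x\<in>Y. norm (p x))"
      using ne assms(1) by (intro cSUP_subset_mono) auto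
    with z p show ?thesis by (force simp: poly_hull_def)
  qed
  with ne assms(1) show "z \<in> poly_hull Y" by (auto simp: poly_hull_def)
qed

lemma normal_exhaustion_absorbs:
  assumes E: "normal_exhaustion E X" and C: "compact C" "C \<subseteq> X"
  shows "\<exists>j. C \<subseteq> E j"
proof -
  let ?U = "\<lambda>j. (top_of_set X) interior_of (E j)"
  have step: "E j \<subseteq> ?U (Suc j)" for j
    using E by (simp add: normal_exhaustion_def)
  have sub: "?U j \<subseteq> E j" for j
    by (rule interior_of_subset)
  have "E j \<subseteq> E (Suc j)" for j
    using step[of j] sub[of "Suc j"] by (rule subset_trans)
  then have mono: "E i \<subseteq> E j" if "i \<le> j" for i j
    using that by (rule lift_Suc_mono_le)
  have "\<exists>T. open T \<and> ?U j = X \<inter> T" for j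
    using openin_interior_of[of "top_of_set X" "E j"] unfolding openin_open .
  then obtain T where T: "\<And>j. open (T j)" "\<And>j. ?U j = X \<inter> T j" by metis
  have "X \<subseteq> (\<Union>j. T j)"
  proof
    fix x assume "x \<in> X"
    then obtain j where "x \<in> E j" using E by (auto simp: normal_exhaustion_def)
    then show "x \<in> (\<Union>j. T j)" using step[of j] T(2)[of "Suc j"] by blast
  qed
  then have "C \<subseteq> (\<Union>j\<in>UNIV. T j)" using C by blast
  then obtain J where J: "finite J" "C \<subseteq> (\<Union>j\<in>J. T j)"
    by (rule compactE_image[OF C(1) T(1)])
  obtain m where m: "\<And>j. j \<in> J \<Longrightarrow> j \<le> m"
    using J(1) unfolding finite_nat_set_iff_bounded_le by auto
  have "C \<subseteq> E m"
  proof
    fix x assume x: "x \<in> C"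
    then obtain j where "j \<in> J" "x \<in> T j" using J by blast
    then have "x \<in> E j" using x C T(2)[of j] sub[of j] by blast
    then show "x \<in> E m" using mono[OF m[OF \<open>j \<in> J\<close>]] by (rule subsetD[rotated])
  qed
  then show ?thesis ..
qed

lemma closed_hull_eq:
  assumes E: "normal_exhaustion E X"
  shows "closed_hull X = (\<Union>j. poly_hull (E j))"
proof -
  have le: "(\<Union>j. poly_hull (F j)) \<subseteq> (\<Union>j. poly_hull (G j))"
    if F: "normal_exhaustion F X" and G: "normal_exhaustion G X" for F G
  proof (rule UN_least)
    fix j
    have "compact (F j)" "F j \<subseteq> X" using F by (auto simp: normal_exhaustion_def)
    then obtain k where "F j \<subseteq> G k" using normal_exhaustion_absorbs[OF G] by blast
    moreover have "compact (G k)" using G by (simp add: normal_exhaustion_def)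
    ultimately show "poly_hull (F j) \<subseteq> (\<Union>j. poly_hull (G j))"
      using poly_hull_mono by blast
  qed
  have "normal_exhaustion (SOME E. normal_exhaustion E X) X"
    using someI[of "\<lambda>E. normal_exhaustion E X", OF E] .
  then show ?thesis
    unfolding closed_hull_def using le E by blast
qed

lemma closed_hull_compact:
  assumes "compact X"
  shows "closed_hull X = poly_hull X"
proof -
  have "(top_of_set X) interior_of X = X"
    by (metis interior_of_topspace topspace_euclidean_subtopology)
  then have "normal_exhaustion (\<lambda>_. X) X"
    using assms by (simp add: normal_exhaustion_def)
  then show ?thesis using closed_hull_eq by fastforce
qed

end

theory Submission
  imports Defs "HOL-Complex_Analysis.Cauchy_Integral_Formula"
begin

text \<open>
  Fix a compact \<open>K\<close> and put \<open>X = K \<union> M\<close>. Carleman approximation on \<open>M\<close> gives back approximation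
  on \<open>X\<close> except on a bounded part, and where approximation is possible the hull cannot grow.

  The first half shows that for some \<open>R\<close>, every continuous function on \<open>X\<close> that vanishes on the ball
  of radius \<open>R\<close> is approximable by entire functions, uniformly on bounded parts of \<open>X\<close>
  (\<open>carleman_imp_tail_approximable\<close>). Otherwise there are non-approximable functions that vanish
  on balls of arbitrarily large radius. A gliding hump adds suitable multiples of them, with radii
  growing so fast that the sum \<open>f\<close> is locally finite, vanishes on \<open>K\<close>, and has the following
  property: no entire function stays within bounded distance of \<open>f\<close> on all of \<open>X\<close>. But an entire
  function within distance 1 of \<open>f\<close> on \<open>M\<close> is also bounded on the compact set \<open>K\<close>, where \<open>f = 0\<close>.

  The second half shows that then the hull of \<open>X\<close> adds no points outside that ball
  (\<open>closed_hull_subset_if_tail_approximable\<close>). For \<open>z \<notin> X\<close> with \<open>norm z > R\<close>, a high power \<open>P\<close> of a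
  linear form is 1 at \<open>z\<close> and small on a ball that is larger than the ball of radius \<open>R\<close>. Off that
  ball \<open>P\<close> is cancelled on \<open>X\<close> by a combination of the functions \<open>w $ i - z $ i\<close> with continuous
  coefficients, which exist because \<open>z \<notin> X\<close> and which vanish on the ball of radius \<open>R\<close>. Replacing
  the coefficients by entire approximations keeps the value at \<open>z\<close> equal to 1 and makes the
  function small on any given bounded part of \<open>X\<close>. So \<open>z\<close> is separated from that part by an entire
  function.

  The hull is defined with polynomials, so this needs that an entire function in several variables
  is a uniform limit of polynomials on bounded sets (\<open>entire_polynomial_approximation\<close>). It is
  obtained from interpolation at roots of unity, one variable at a time: sample values of an entire
  function are visibly entire in the remaining variables, whereas for Taylor coefficients this
  needs differentiation under an integral.
\<close>

section \<open>The algebra of entire functions\<close>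

lemma entire_const: "entire (\<lambda>z. c)"
  unfolding entire_def by (intro allI exI[of _ "\<lambda>_. 0"]) auto

lemma entire_coord: "entire (\<lambda>z. z $ i)"
  unfolding entire_def
  by (intro allI exI[of _ "\<lambda>v. v $ i"]) (auto intro: bounded_linear_imp_has_derivative)

lemma entire_add:
  assumes "entire f" "entire g"
  shows "entire (\<lambda>z. f z + g z)"
  unfolding entire_def
proof
  fix z
  obtain D E where "(f has_derivative D) (at z)" "\<And>c v. D (c *s v) = c * D v"
    "(g has_derivative E) (at z)" "\<And>c v. E (c *s v) = c * E v"
    using assms unfolding entire_def by meson
  then show "\<exists>D. ((\<lambda>z. f z + g z) has_derivative D) (at z) \<and> (\<forall>c v. D (c *s v) = c * D v)"
    by (intro exI[of _ "\<lambda>v. D v + E v"]) (auto intro: has_derivative_add simp: algebra_simps)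
qed

lemma entire_mult:
  assumes "entire f" "entire g"
  shows "entire (\<lambda>z. f z * g z)"
  unfolding entire_def
proof
  fix z
  obtain D E where "(f has_derivative D) (at z)" "\<And>c v. D (c *s v) = c * D v"
    "(g has_derivative E) (at z)" "\<And>c v. E (c *s v) = c * E v"
    using assms unfolding entire_def by meson
  then show "\<exists>D. ((\<lambda>z. f z * g z) has_derivative D) (at z) \<and> (\<forall>c v. D (c *s v) = c * D v)"
    by (intro exI[of _ "\<lambda>v. f z * E v + D v * g z"]) (simp add: has_derivative_mult, simp add: algebra_simps)
qed

lemma entire_diff:
  assumes "entire f" "entire g"
  shows "entire (\<lambda>z. f z - g z)"
  using entire_add[OF assms(1) entire_mult[OF entire_const[of "-1"] assms(2)]] by simp

lemma entire_sum:
  assumes "\<And>t. t \<in> T \<Longrightarrow> entire (f t)"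
  shows "entire (\<lambda>z. \<Sum>t\<in>T. f t z)"
  using assms by (induction T rule: infinite_finite_induct) (auto intro: entire_const entire_add)

lemma entire_power: "entire f \<Longrightarrow> entire (\<lambda>z. f z ^ k)"
  by (induction k) (auto intro: entire_const entire_mult)

lemma entire_continuous_on: "entire f \<Longrightarrow> continuous_on S f"
  unfolding entire_def
  by (meson continuous_at_imp_continuous_on has_derivative_continuous)

section \<open>Sampling an entire function of one variable\<close>

text \<open>
  Orthogonality of the characters of the group of \<open>N\<close>-th roots of unity: a geometric sum whose
  ratio is an \<open>N\<close>-th root of unity vanishes unless the ratio is 1.
\<close>

lemma sum_powers_root_of_unity:
  fixes k l N :: nat
  assumes "k < N" "l < N"
  defines "\<omega> \<equiv> cis (2 * pi / real N)"
  shows "(\<Sum>j<N. (\<omega> ^ j) ^ l / (\<omega> ^ j) ^ k) = (if k = l then of_nat N else 0)"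
proof (cases "k = l")
  case True
  then show ?thesis by (simp add: \<omega>_def)
next
  case False
  define q where "q = \<omega> ^ l / \<omega> ^ k"
  have \<omega>0: "\<omega> \<noteq> 0" by (simp add: \<omega>_def)
  have N: "N > 0" using assms(1) by simp
  have "\<omega> ^ N = 1"
    using N by (simp add: \<omega>_def Complex.DeMoivre)
  then have "q ^ N = 1"
    by (metis (no_types, lifting) div_by_1 power_commutes power_divide power_mult power_one q_def mult.commute)
  have "q \<noteq> 1"
  proof
    assume "q = 1"
    then have eq: "\<omega> ^ l = \<omega> ^ k" using \<omega>0 by (simp add: q_def)
    have "\<omega> ^ j = cis (2 * pi * real j / real N)" for j
      by (simp add: \<omega>_def Complex.DeMoivre mult.commute)
    moreover have "inj_on (\<lambda>j. cis (2 * pi * real j / real N)) {..<N}"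
      using Complex.bij_betw_roots_unity[OF N] by (auto simp: bij_betw_def)
    ultimately show False using eq False assms by (auto simp: inj_on_def)
  qed
  have "(\<Sum>j<N. (\<omega> ^ j) ^ l / (\<omega> ^ j) ^ k) = (\<Sum>j<N. q ^ j)"
    by (simp add: q_def power_divide mult.commute flip: power_mult)
  also have "\<dots> = 0"
    using \<open>q \<noteq> 1\<close> \<open>q ^ N = 1\<close> by (simp add: sum_gp_strict)
  finally show ?thesis using False by simp
qed

definition sample_node :: "real \<Rightarrow> nat \<Rightarrow> nat \<Rightarrow> complex" where
  "sample_node R N j = of_real R * cis (2 * pi / real N) ^ j"

text \<open>
  The Lagrange basis polynomial of the node with index \<open>j\<close>, summed as a geometric series; this form
  shows at once that it is bounded by 1 on the disc of radius \<open>R\<close>.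
\<close>

definition sample_weight :: "real \<Rightarrow> nat \<Rightarrow> nat \<Rightarrow> complex \<Rightarrow> complex" where
  "sample_weight R N j z = (\<Sum>k<N. (z / sample_node R N j) ^ k) / of_nat N"

lemma norm_sample_node: "0 \<le> R \<Longrightarrow> norm (sample_node R N j) = R"
  by (simp add: sample_node_def norm_mult norm_power)

lemma norm_sample_weight_le:
  assumes "0 < R" "norm z \<le> R"
  shows "norm (sample_weight R N j z) \<le> 1"
proof (cases "N = 0")
  case False
  have "norm ((z / sample_node R N j) ^ k) \<le> 1" for k
    using assms by (simp add: norm_power norm_divide norm_sample_node power_le_one)
  then have "norm (\<Sum>k<N. (z / sample_node R N j) ^ k) \<le> real N"
    using sum_norm_bound[of "{..<N}" "\<lambda>k. (z / sample_node R N j) ^ k" 1] by simp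
  then show ?thesis
    using False by (simp add: sample_weight_def norm_divide)
qed (simp add: sample_weight_def)

lemma sampling_exact_power:
  assumes "0 < R" "l < N"
  shows "(\<Sum>j<N. sample_weight R N j z * sample_node R N j ^ l) = z ^ l"
proof -
  define \<omega> where "\<omega> = cis (2 * pi / real N)"
  have "(\<Sum>j<N. sample_weight R N j z * sample_node R N j ^ l)
      = (\<Sum>j<N. \<Sum>k<N. z ^ k * of_real R ^ l / of_real R ^ k / of_nat N * ((\<omega> ^ j) ^ l / (\<omega> ^ j) ^ k))"
    unfolding sample_weight_def sample_node_def \<omega>_def[symmetric]
    by (simp add: sum_distrib_left sum_distrib_right
        sum_divide_distrib power_mult_distrib power_divide mult_ac)
  also have "\<dots> = (\<Sum>k<N. z ^ k * of_real R ^ l / of_real R ^ k / of_nat N *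
      (\<Sum>j<N. (\<omega> ^ j) ^ l / (\<omega> ^ j) ^ k))"
    by (subst sum.swap) (simp add: sum_distrib_left)
  also have "\<dots> = (\<Sum>k<N. if k = l then z ^ k * of_real R ^ l / of_real R ^ k / of_nat N * of_nat N else 0)"
    using assms(2) by (intro sum.cong) (auto simp: \<omega>_def sum_powers_root_of_unity)
  also have "\<dots> = z ^ l"
    using assms by simp
  finally show ?thesis .
qed

text \<open>
  Cauchy's inequality on the circle of radius \<open>2 * R\<close> bounds the \<open>k\<close>-th Taylor term on the disc of
  radius \<open>R\<close> by \<open>B / 2 ^ k\<close>.
\<close>

lemma taylor_remainder_le:
  assumes h: "h holomorphic_on UNIV" and R: "0 < R"
    and B: "\<And>\<zeta>. norm \<zeta> \<le> 2 * R \<Longrightarrow> norm (h \<zeta>) \<le> B" and z: "norm z \<le> R"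
  shows "norm (h z - (\<Sum>k<N. (deriv ^^ k) h 0 / fact k * z ^ k)) \<le> 2 * B / 2 ^ N"
proof -
  let ?a = "\<lambda>k. (deriv ^^ k) h 0 / fact k * z ^ k"
  have "(\<lambda>k. (deriv ^^ k) h 0 / fact k * (z - 0) ^ k) sums h z"
    by (rule holomorphic_power_series[where r = "R + 1"])
      (use h z R in \<open>auto intro: holomorphic_on_subset\<close>)
  then have sums: "?a sums h z" by simp
  have B0: "0 \<le> B"
    using B[of 0] R by (auto intro: order_trans[OF norm_ge_zero])
  have a: "norm (?a k) \<le> B * (1/2) ^ k" for k
  proof -
    have "norm ((deriv ^^ k) h 0) \<le> fact k * B / (2 * R) ^ k"
      by (rule Cauchy_inequality)
        (use h R B in \<open>auto intro: holomorphic_on_subset holomorphic_on_imp_continuous_on\<close>)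
    then have "norm ((deriv ^^ k) h 0) / fact k \<le> B / (2 * R) ^ k"
      by (simp add: field_simps)
    moreover have "norm z ^ k \<le> R ^ k" using z by (intro power_mono) auto
    ultimately have "norm ((deriv ^^ k) h 0) / fact k * norm z ^ k \<le> B / (2 * R) ^ k * R ^ k"
      using R B0 by (intro mult_mono) auto
    also have "\<dots> = B * (1/2) ^ k"
      using R by (simp add: power_mult_distrib power_divide)
    finally show ?thesis by (simp add: norm_mult norm_divide norm_power)
  qed
  have "(\<lambda>k. ?a (k + N)) sums (h z - (\<Sum>k<N. ?a k))"
    by (rule sums_split_initial_segment[OF sums])
  moreover have "(\<lambda>k. B * (1/2) ^ (k + N)) sums (2 * B / 2 ^ N)"
    using sums_mult[OF geometric_sums[of "1/2::real"], of "B / 2 ^ N"]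
    by (simp add: power_add power_divide mult_ac)
  ultimately show ?thesis
    by (metis (no_types, lifting) a norm_suminf_le sums_summable sums_unique)
qed

text \<open>
  Interpolation reproduces the Taylor polynomial of degree less than \<open>N\<close>, so only the Taylor
  remainder contributes, once at the point and once at each node. There are \<open>N\<close> weights of norm at
  most 1, which is harmless against the factor \<open>2 ^ N\<close>. The bound depends on \<open>h\<close> only through
  \<open>B\<close>, hence it is uniform over the slices of a function of several variables.
\<close>

lemma sampling_error_le:
  assumes h: "h holomorphic_on UNIV" and R: "0 < R"
    and B: "\<And>\<zeta>. norm \<zeta> \<le> 2 * R \<Longrightarrow> norm (h \<zeta>) \<le> B" and z: "norm z \<le> R"
  shows "norm (h z - (\<Sum>j<N. sample_weight R N j z * h (sample_node R N j)))
    \<le> (1 + real N) * (2 * B / 2 ^ N)"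
proof -
  define T where "T w = (\<Sum>k<N. (deriv ^^ k) h 0 / fact k * w ^ k)" for w
  let ?L = "\<lambda>j. sample_weight R N j z" and ?w = "sample_node R N"
  have rem: "norm (h w - T w) \<le> 2 * B / 2 ^ N" if "norm w \<le> R" for w
    unfolding T_def using taylor_remainder_le[OF h R B that] by simp
  have "(\<Sum>j<N. ?L j * T (?w j)) = (\<Sum>j<N. \<Sum>k<N. (deriv ^^ k) h 0 / fact k * (?L j * ?w j ^ k))"
    by (simp add: T_def sum_distrib_left mult_ac)
  also have "\<dots> = (\<Sum>k<N. (deriv ^^ k) h 0 / fact k * (\<Sum>j<N. ?L j * ?w j ^ k))"
    by (subst sum.swap) (simp add: sum_distrib_left)
  also have "\<dots> = T z"
    unfolding T_def using R by (intro sum.cong) (auto simp: sampling_exact_power)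
  finally have "h z - (\<Sum>j<N. ?L j * h (?w j)) = (h z - T z) - (\<Sum>j<N. ?L j * (h (?w j) - T (?w j)))"
    by (simp add: algebra_simps sum_subtractf)
  also have "norm \<dots> \<le> norm (h z - T z) + norm (\<Sum>j<N. ?L j * (h (?w j) - T (?w j)))"
    by (rule norm_triangle_ineq4)
  also have "norm (\<Sum>j<N. ?L j * (h (?w j) - T (?w j))) \<le> (\<Sum>j<N. 1 * (2 * B / 2 ^ N))"
  proof (rule sum_norm_le)
    fix j
    show "norm (?L j * (h (?w j) - T (?w j))) \<le> 1 * (2 * B / 2 ^ N)"
      unfolding norm_mult using R z
      by (intro mult_mono norm_sample_weight_le rem) (auto simp: norm_sample_node)
  qed
  finally show ?thesis using rem[OF z] by (simp add: algebra_simps add_divide_distrib)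
qed

section \<open>Entire functions are limits of polynomials\<close>

text \<open>
  Lets the terms of a polynomial carry an arbitrary index set, in which a multi-index may occur
  repeatedly; sums and products then need no collection of like terms.
\<close>

lemma complex_polynomialI:
  fixes \<alpha> :: "'t \<Rightarrow> 'n::finite \<Rightarrow> nat"
  assumes "finite T" and p: "\<And>z. p z = (\<Sum>t\<in>T. c t * (\<Prod>i\<in>UNIV. (z $ i) ^ \<alpha> t i))"
  shows "complex_polynomial p"
  unfolding complex_polynomial_def
proof (intro exI conjI)
  show "finite (\<alpha> ` T)" using assms by simp
  show "p = (\<lambda>z. \<Sum>a\<in>\<alpha> ` T. (\<Sum>t\<in>{t\<in>T. \<alpha> t = a}. c t) * (\<Prod>i\<in>UNIV. (z $ i) ^ a i))"
  proof
    fix z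
    have "p z = (\<Sum>a\<in>\<alpha> ` T. \<Sum>t\<in>{t\<in>T. \<alpha> t = a}. c t * (\<Prod>i\<in>UNIV. (z $ i) ^ \<alpha> t i))"
      unfolding p by (rule sum.image_gen[OF assms(1)])
    also have "\<dots> = (\<Sum>a\<in>\<alpha> ` T. (\<Sum>t\<in>{t\<in>T. \<alpha> t = a}. c t) * (\<Prod>i\<in>UNIV. (z $ i) ^ a i))"
      by (auto simp: sum_distrib_right intro!: sum.cong)
    finally show "p z = \<dots>" .
  qed
qed

lemma complex_polynomial_const: "complex_polynomial (\<lambda>z. c)"
  by (rule complex_polynomialI[where T = "{()}" and c = "\<lambda>_. c" and \<alpha> = "\<lambda>_ _. 0"]) auto

lemma complex_polynomial_coord: "complex_polynomial (\<lambda>z. z $ i)"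
proof (rule complex_polynomialI[where T = "{()}" and c = "\<lambda>_. 1" and \<alpha> = "\<lambda>_ j. if j = i then 1 else 0"])
  fix z :: "complex ^ 'a"
  have "(\<Prod>j\<in>UNIV. (z $ j) ^ (if j = i then 1 else 0)) = (\<Prod>j\<in>UNIV. if j = i then z $ j else 1)"
    by (rule prod.cong) auto
  then show "z $ i = (\<Sum>t\<in>{()}. 1 * (\<Prod>j\<in>UNIV. (z $ j) ^ (if j = i then 1 else 0)))"
    by simp
qed auto

lemma complex_polynomial_add:
  assumes "complex_polynomial p" "complex_polynomial q"
  shows "complex_polynomial (\<lambda>z. p z + q z)"
proof -
  obtain A c where A: "finite A" "p = (\<lambda>z. \<Sum>\<alpha>\<in>A. c \<alpha> * (\<Prod>i\<in>UNIV. (z $ i) ^ \<alpha> i))"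
    using assms(1) unfolding complex_polynomial_def by blast
  obtain B d where B: "finite B" "q = (\<lambda>z. \<Sum>\<alpha>\<in>B. d \<alpha> * (\<Prod>i\<in>UNIV. (z $ i) ^ \<alpha> i))"
    using assms(2) unfolding complex_polynomial_def by blast
  show ?thesis
    by (rule complex_polynomialI[where T = "A <+> B" and c = "case_sum c d" and \<alpha> = "case_sum id id"])
      (use A B in \<open>auto simp: sum.Plus\<close>)
qed

lemma complex_polynomial_mult:
  assumes "complex_polynomial p" "complex_polynomial q"
  shows "complex_polynomial (\<lambda>z. p z * q z)"
proof -
  obtain A c where A: "finite A" "p = (\<lambda>z. \<Sum>\<alpha>\<in>A. c \<alpha> * (\<Prod>i\<in>UNIV. (z $ i) ^ \<alpha> i))"
    using assms(1) unfolding complex_polynomial_def by blast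
  obtain B d where B: "finite B" "q = (\<lambda>z. \<Sum>\<alpha>\<in>B. d \<alpha> * (\<Prod>i\<in>UNIV. (z $ i) ^ \<alpha> i))"
    using assms(2) unfolding complex_polynomial_def by blast
  show ?thesis
  proof (rule complex_polynomialI[where T = "A \<times> B" and c = "\<lambda>(a, b). c a * d b"
        and \<alpha> = "\<lambda>(a, b) i. a i + b i"])
    show "p z * q z = (\<Sum>t\<in>A \<times> B. (case t of (a, b) \<Rightarrow> c a * d b) *
        (\<Prod>i\<in>UNIV. (z $ i) ^ (case t of (a, b) \<Rightarrow> \<lambda>i. a i + b i) i))" for z
      by (simp add: A B sum_product sum.cartesian_product power_add prod.distrib mult_ac case_prod_unfold)
  qed (use A B in auto)
qed

lemma complex_polynomial_sum:
  assumes "\<And>t. t \<in> T \<Longrightarrow> complex_polynomial (p t)"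
  shows "complex_polynomial (\<lambda>z. \<Sum>t\<in>T. p t z)"
  using assms
  by (induction T rule: infinite_finite_induct) (auto intro: complex_polynomial_const complex_polynomial_add)

lemma complex_polynomial_power:
  assumes "complex_polynomial p"
  shows "complex_polynomial (\<lambda>z. p z ^ k)"
  by (induction k) (auto intro: assms complex_polynomial_const complex_polynomial_mult)

lemma complex_polynomial_sample_weight: "complex_polynomial (\<lambda>z. sample_weight R N j (z $ i))"
proof -
  have "complex_polynomial (\<lambda>z. \<Sum>k<N. 1 / of_nat N * (1 / sample_node R N j * (z $ i)) ^ k)"
    by (intro complex_polynomial_sum complex_polynomial_mult complex_polynomial_power
        complex_polynomial_const complex_polynomial_coord)
  then show ?thesis by (simp add: sample_weight_def sum_divide_distrib)
qed

definition upd :: "complex ^ 'n \<Rightarrow> 'n \<Rightarrow> complex \<Rightarrow> complex ^ 'n" where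
  "upd z i \<zeta> = (\<chi> j. if j = i then \<zeta> else z $ j)"

lemma upd_nth: "upd z i \<zeta> $ j = (if j = i then \<zeta> else z $ j)"
  by (simp add: upd_def)

lemma upd_same: "upd z i (z $ i) = z"
  by (simp add: upd_def vec_eq_iff)

lemma upd_twice: "upd (upd z i \<zeta>) i \<xi> = upd z i \<xi>"
  by (simp add: upd_def vec_eq_iff)

lemma upd_commute: "i \<noteq> j \<Longrightarrow> upd (upd z i \<zeta>) j \<xi> = upd (upd z j \<xi>) i \<zeta>"
  by (auto simp: upd_def vec_eq_iff)

lemma continuous_on_upd: "continuous_on S (\<lambda>z. upd z i \<zeta>)"
  unfolding upd_def
proof (rule continuous_on_vec_lambda)
  show "continuous_on S (\<lambda>z. if j = i then \<zeta> else z $ j)" for j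
    by (cases "j = i") (auto intro: continuous_intros)
qed

text \<open>
  This notion is inherited by \<open>\<lambda>z. f (upd z i \<xi>)\<close> for trivial reasons, which is what the induction
  over the variables below requires.
\<close>

definition separately_entire :: "(complex ^ 'n \<Rightarrow> complex) \<Rightarrow> bool" where
  "separately_entire f \<longleftrightarrow>
     continuous_on UNIV f \<and> (\<forall>z i. (\<lambda>\<zeta>. f (upd z i \<zeta>)) holomorphic_on UNIV)"

lemma separately_entire_upd:
  assumes "separately_entire f"
  shows "separately_entire (\<lambda>z. f (upd z i \<xi>))"
  unfolding separately_entire_def
proof (intro conjI allI)
  show "continuous_on UNIV (\<lambda>z. f (upd z i \<xi>))"
    using assms unfolding separately_entire_def
    by (intro continuous_on_compose2[OF _ continuous_on_upd]) auto
  show "(\<lambda>\<zeta>. f (upd (upd z j \<zeta>) i \<xi>)) holomorphic_on UNIV" for z j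
    using assms by (cases "j = i") (simp_all add: upd_twice upd_commute[of j i] separately_entire_def)
qed

lemma entire_imp_separately_entire:
  fixes f :: "complex ^ 'n \<Rightarrow> complex"
  assumes "entire f"
  shows "separately_entire f"
  unfolding separately_entire_def
proof (intro conjI allI)
  show "continuous_on UNIV f"
    using assms by (rule entire_continuous_on)
  fix z i
  have "\<exists>d. ((\<lambda>\<zeta>. f (upd z i \<zeta>)) has_field_derivative d) (at \<zeta>)" for \<zeta>
  proof -
    obtain D where D: "(f has_derivative D) (at (upd z i \<zeta>))" "\<And>c v. D (c *s v) = c * D v"
      using assms unfolding entire_def by blast
    define b where "b = upd z i 0"
    have eq: "upd z i \<xi> = b + \<xi> *s axis i 1" for \<xi>
      by (auto simp: b_def vec_eq_iff upd_def axis_def)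
    have "bounded_linear (\<lambda>h. h *s axis i 1 :: complex ^ 'n)"
      unfolding linear_conv_bounded_linear[symmetric]
      by (rule linearI) (auto simp: vec_eq_iff algebra_simps)
    then have "((\<lambda>\<xi>. b + \<xi> *s axis i 1) has_derivative (\<lambda>h. 0 + h *s axis i 1)) (at \<zeta>)"
      by (intro has_derivative_add has_derivative_const bounded_linear_imp_has_derivative)
    then have "((\<lambda>\<xi>. upd z i \<xi>) has_derivative (\<lambda>h. h *s axis i 1)) (at \<zeta>)"
      by (simp add: eq)
    then have "((\<lambda>\<zeta>. f (upd z i \<zeta>)) has_derivative (\<lambda>h. D (h *s axis i 1))) (at \<zeta>)"
      using D(1) by (rule has_derivative_compose)
    then have "((\<lambda>\<zeta>. f (upd z i \<zeta>)) has_field_derivative D (axis i 1)) (at \<zeta>)"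
      by (simp add: has_field_derivative_def D(2) mult_commute_abs)
    then show ?thesis ..
  qed
  then show "(\<lambda>\<zeta>. f (upd z i \<zeta>)) holomorphic_on UNIV"
    by (simp add: holomorphic_on_open)
qed


lemma sample_error_tendsto_0: "(\<lambda>N. (1 + real N) * (2 * B / 2 ^ N)) \<longlonglongrightarrow> 0"
proof -
  have "(\<lambda>N. 2 * B * ((1/2) ^ N + real N * (1/2) ^ N)) \<longlonglongrightarrow> 2 * B * (0 + 0)"
    by (intro tendsto_intros LIMSEQ_realpow_zero powser_times_n_limit_0) auto
  then show ?thesis by (simp add: field_simps power_divide)
qed

lemma norm_upd_le:
  fixes z :: "complex ^ 'n"
  shows "norm (upd z i \<zeta>) \<le> norm z + norm \<zeta>"
proof -
  have "upd z i \<zeta> = upd z i 0 + axis i \<zeta>"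
    by (auto simp: vec_eq_iff upd_def axis_def)
  then have "norm (upd z i \<zeta>) \<le> norm (upd z i 0) + norm (axis i \<zeta> :: complex ^ 'n)"
    using norm_triangle_ineq by metis
  moreover have "norm (upd z i 0) \<le> norm z"
    unfolding norm_vec_def by (intro L2_set_mono) (auto simp: upd_def)
  moreover have "norm (axis i \<zeta> :: complex ^ 'n) = norm \<zeta>"
    by (simp add: norm_vec_def L2_set_def axis_def if_distrib[of norm] if_distrib[of "\<lambda>x. x\<^sup>2"] cong: if_cong)
  ultimately show ?thesis by simp
qed

text \<open>
  Induction on the set of variables on which \<open>f\<close> depends. Sampling in one variable \<open>i\<close> replaces \<open>f\<close>
  by a sum of polynomials in \<open>z $ i\<close> times functions that no longer depend on \<open>z $ i\<close>, and these are
  approximable by the induction hypothesis.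
\<close>

lemma polynomial_approximation_separately_entire:
  fixes f :: "complex ^ 'n \<Rightarrow> complex"
  assumes "finite I" and f: "separately_entire f"
    and dep: "\<And>z w. (\<And>i. i \<in> I \<Longrightarrow> z $ i = w $ i) \<Longrightarrow> f z = f w"
    and R: "0 < R" and \<epsilon>: "0 < \<epsilon>"
  shows "\<exists>p. complex_polynomial p \<and> (\<forall>z\<in>cball 0 R. norm (f z - p z) \<le> \<epsilon>)"
  using assms(1) f dep \<epsilon>
proof (induction I arbitrary: f \<epsilon> rule: finite_induct)
  case empty
  have "f z = f 0" for z
    using empty.prems(2)[of z 0] by simp
  then show ?case
    using \<open>0 < \<epsilon>\<close> by (metis (no_types) complex_polynomial_const diff_self less_imp_le norm_zero)
next
  case (insert i I)
  have cont: "continuous_on UNIV f"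
    using insert.prems(1) by (simp add: separately_entire_def)
  have "compact (f ` cball 0 (3 * R))"
    by (rule compact_continuous_image) (auto intro: continuous_on_subset[OF cont])
  then obtain B where B: "\<And>z. z \<in> cball 0 (3 * R) \<Longrightarrow> norm (f z) \<le> B"
    using compact_imp_bounded bounded_iff by (metis imageI)
  have "\<forall>\<^sub>F N in sequentially. (1 + real N) * (2 * B / 2 ^ N) < \<epsilon> / 2"
    by (rule order_tendstoD(2)[OF sample_error_tendsto_0]) (use insert.prems(3) in simp)
  then obtain N where N: "(1 + real N) * (2 * B / 2 ^ N) < \<epsilon> / 2"
    by (auto simp: eventually_sequentially)
  \<comment> \<open>The \<open>N\<close> weights have norm at most 1, so errors \<open>\<delta>\<close> in the coefficients add up to at most \<open>\<epsilon> / 2\<close>.\<close>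
  define \<delta> where "\<delta> = \<epsilon> / 2 / (1 + real N)"
  have \<delta>: "0 < \<delta>" using insert.prems(3) by (simp add: \<delta>_def add_pos_nonneg)
  let ?w = "sample_node R N" and ?L = "sample_weight R N"
  have "\<exists>p. complex_polynomial p \<and> (\<forall>z\<in>cball 0 R. norm (f (upd z i (?w j)) - p z) \<le> \<delta>)" for j
  proof (rule insert.IH[OF separately_entire_upd[OF insert.prems(1)] _ \<delta>])
    show "f (upd z i (?w j)) = f (upd w i (?w j))" if "\<And>i. i \<in> I \<Longrightarrow> z $ i = w $ i" for z w
      by (rule insert.prems(2)) (use that in \<open>auto simp: upd_nth\<close>)
  qed
  then obtain p where p: "\<And>j. complex_polynomial (p j)"
    "\<And>j z. z \<in> cball 0 R \<Longrightarrow> norm (f (upd z i (?w j)) - p j z) \<le> \<delta>"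
    by metis
  show ?case
  proof (intro exI conjI ballI)
    show "complex_polynomial (\<lambda>z. \<Sum>j<N. ?L j (z $ i) * p j z)"
      by (intro complex_polynomial_sum complex_polynomial_mult complex_polynomial_sample_weight p)
    fix z :: "complex ^ 'n" assume z: "z \<in> cball 0 R"
    then have zi: "norm (z $ i) \<le> R"
      using Finite_Cartesian_Product.norm_nth_le[of z i] by simp
    have hol: "(\<lambda>\<zeta>. f (upd z i \<zeta>)) holomorphic_on UNIV"
      using insert.prems(1) by (simp add: separately_entire_def)
    have bd: "norm (f (upd z i \<zeta>)) \<le> B" if "norm \<zeta> \<le> 2 * R" for \<zeta>
      by (rule B) (use norm_upd_le[of z i \<zeta>] z that in simp)
    have interpolation: "norm (f z - (\<Sum>j<N. ?L j (z $ i) * f (upd z i (?w j)))) \<le> \<epsilon> / 2"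
      using sampling_error_le[OF hol R bd zi, of N] N by (simp add: upd_same)
    have "norm (\<Sum>j<N. ?L j (z $ i) * (f (upd z i (?w j)) - p j z)) \<le> (\<Sum>j<N. 1 * \<delta>)"
      by (rule sum_norm_le) (unfold norm_mult, intro mult_mono norm_sample_weight_le R zi p z, auto)
    also have "\<dots> \<le> \<epsilon> / 2"
      using insert.prems(3) by (simp add: \<delta>_def field_simps)
    finally have coefficients: "norm (\<Sum>j<N. ?L j (z $ i) * (f (upd z i (?w j)) - p j z)) \<le> \<epsilon> / 2" .
    have split: "f z - (\<Sum>j<N. ?L j (z $ i) * p j z)
        = (f z - (\<Sum>j<N. ?L j (z $ i) * f (upd z i (?w j))))
          + (\<Sum>j<N. ?L j (z $ i) * (f (upd z i (?w j)) - p j z))"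
      by (simp add: algebra_simps sum_subtractf)
    show "norm (f z - (\<Sum>j<N. ?L j (z $ i) * p j z)) \<le> \<epsilon>"
      unfolding split by (rule norm_triangle_le) (use interpolation coefficients in linarith)
  qed
qed

lemma entire_polynomial_approximation:
  fixes f :: "complex ^ 'n \<Rightarrow> complex"
  assumes "entire f" "bounded S" "0 < \<epsilon>"
  shows "\<exists>p. complex_polynomial p \<and> (\<forall>z\<in>S. norm (f z - p z) \<le> \<epsilon>)"
proof -
  obtain R where R: "0 < R" "\<And>z. z \<in> S \<Longrightarrow> norm z \<le> R"
    using assms(2) bounded_pos by blast
  have "\<exists>p. complex_polynomial p \<and> (\<forall>z\<in>cball 0 R. norm (f z - p z) \<le> \<epsilon>)"
  proof (rule polynomial_approximation_separately_entire[OF finite])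
    show "f z = f w" if "\<And>i. i \<in> UNIV \<Longrightarrow> z $ i = w $ i" for z w
      using that by (metis UNIV_I vec_eq_iff)
  qed (use R assms entire_imp_separately_entire in auto)
  then show ?thesis
    using R(2) by (meson mem_cball_0)
qed

text \<open>
  Because polynomials approximate \<open>H\<close> on the bounded set \<open>insert z Y\<close>, the inequality that defines
  the polynomial hull passes to entire functions.
\<close>

lemma entire_poly_hull_le:
  assumes z: "z \<in> poly_hull Y" and "bounded Y" and H: "entire H"
    and b: "\<And>w. w \<in> Y \<Longrightarrow> norm (H w) \<le> b"
  shows "norm (H z) \<le> b"
proof (rule field_le_epsilon)
  fix \<epsilon> :: real assume "0 < \<epsilon>"
  obtain p where p: "complex_polynomial p" "\<And>w. w \<in> insert z Y \<Longrightarrow> norm (H w - p w) \<le> \<epsilon> / 2"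
    using entire_polynomial_approximation[OF H, of "insert z Y" "\<epsilon> / 2"] \<open>bounded Y\<close> \<open>0 < \<epsilon>\<close> by auto
  have "norm (p w) \<le> b + \<epsilon> / 2" if "w \<in> Y" for w
    using p(2)[of w] b[OF that] that norm_triangle_ineq2[of "p w" "H w"] by (simp add: norm_minus_commute)
  then have "(SUP w\<in>Y. norm (p w)) \<le> b + \<epsilon> / 2"
    using z by (intro cSUP_least) (auto simp: poly_hull_def)
  moreover have "norm (p z) \<le> (SUP w\<in>Y. norm (p w))"
    using z p(1) by (simp add: poly_hull_def)
  moreover have "norm (H z) \<le> norm (p z) + \<epsilon> / 2"
    using p(2)[of z] norm_triangle_ineq2[of "H z" "p z"] by simp
  ultimately show "norm (H z) \<le> b + \<epsilon>" by simp
qed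

section \<open>Approximation far out and the hull\<close>

text \<open>
  In the language of duality, this says that every measure of bounded support on \<open>X\<close> that
  annihilates the entire functions lives on the ball of radius \<open>R\<close>.
\<close>

definition tail_approximable :: "(complex ^ 'n) set \<Rightarrow> real \<Rightarrow> bool" where
  "tail_approximable X R \<longleftrightarrow>
     (\<forall>\<phi> S \<delta>. continuous_on X \<phi> \<and> (\<forall>x\<in>cball 0 R. \<phi> x = 0) \<and> 0 < \<delta> \<longrightarrow>
        (\<exists>g. entire g \<and> (\<forall>x\<in>X \<inter> cball 0 S. norm (g x - \<phi> x) < \<delta>)))"

lemma norm_hermitian_product_le:
  fixes w z :: "complex ^ 'n"
  shows "norm (\<Sum>i\<in>UNIV. w $ i * cnj (z $ i)) \<le> norm w * norm z"
proof -
  have "norm (\<Sum>i\<in>UNIV. w $ i * cnj (z $ i)) \<le> (\<Sum>i\<in>UNIV. \<bar>norm (w $ i)\<bar> * \<bar>norm (z $ i)\<bar>)"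
    by (rule sum_norm_le) (simp add: norm_mult)
  also have "\<dots> \<le> norm w * norm z"
    unfolding norm_vec_def by (rule L2_set_mult_ineq)
  finally show ?thesis .
qed

lemma hermitian_product_self:
  fixes z :: "complex ^ 'n"
  shows "(\<Sum>i\<in>UNIV. z $ i * cnj (z $ i)) = of_real ((norm z)\<^sup>2)"
proof -
  have "(norm z)\<^sup>2 = (\<Sum>i\<in>UNIV. (norm (z $ i))\<^sup>2)"
    by (simp add: norm_vec_def L2_set_def sum_nonneg)
  then show ?thesis by (simp add: complex_norm_square[symmetric] del: of_real_power) 
qed

text \<open>
  A point \<open>z\<close> of the hull outside \<open>X\<close> and the ball would contradict the existence of an entire
  function \<open>H\<close> with \<open>H z = 1\<close> that is at most 3/4 in norm on the bounded part of \<open>X\<close> whose hull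
  contains \<open>z\<close>.
\<close>

lemma closed_hull_subset_if_tail_approximable:
  fixes X :: "(complex ^ 'n) set"
  assumes X: "closed X" and tail: "tail_approximable X R" and R: "0 \<le> R"
    and z: "z \<in> closed_hull X" and zR: "R < norm z"
  shows "z \<in> X"
proof (rule ccontr)
  assume zX: "z \<notin> X"
  obtain E where E: "normal_exhaustion E X"
    using normal_exhaustion_exists[OF X] by blast
  then obtain j where j: "z \<in> poly_hull (E j)"
    using z by (auto simp: closed_hull_eq)
  define Y where "Y = E j"
  have zY: "z \<in> poly_hull Y" and YX: "Y \<subseteq> X" and Yb: "bounded Y"
    using j E by (auto simp: Y_def normal_exhaustion_def compact_imp_bounded)
  obtain S where S: "0 < S" "\<And>w. w \<in> Y \<Longrightarrow> norm w \<le> S"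
    using Yb bounded_pos by blast
  obtain r where r: "R < r" "r < norm z" using dense zR by blast
  have z0: "norm z > 0" using R zR by linarith
  \<comment> \<open>A continuous cutoff that vanishes on the ball of radius \<open>R\<close> and equals 1 off the ball of radius \<open>r\<close>.\<close>
  define \<kappa> where "\<kappa> w = min 1 (max 0 ((norm w - R) / (r - R)))" for w :: "complex ^ 'n"
  have \<kappa>0: "\<kappa> w = 0" if "norm w \<le> R" for w
    using that r by (simp add: \<kappa>_def divide_nonpos_pos)
  have \<kappa>1: "\<kappa> w = 1" if "r \<le> norm w" for w
    using that r by (simp add: \<kappa>_def)
  have \<kappa>01: "0 \<le> \<kappa> w" "\<kappa> w \<le> 1" for w by (auto simp: \<kappa>_def)
  have \<kappa>c: "continuous_on UNIV \<kappa>"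
    unfolding \<kappa>_def using r by (intro continuous_intros) auto
  \<comment> \<open>A linear form with \<open>l z = 1\<close>; its powers are small on the ball of radius \<open>r < norm z\<close>.\<close>
  define l where "l w = (\<Sum>i\<in>UNIV. w $ i * cnj (z $ i)) / of_real ((norm z)\<^sup>2)" for w
  have lz: "l z = 1"
    using z0 by (simp add: l_def hermitian_product_self)
  have l_entire: "entire l"
  proof -
    have "entire (\<lambda>w. \<Sum>i\<in>UNIV. (cnj (z $ i) / of_real ((norm z)\<^sup>2)) * w $ i)"
      by (intro entire_sum entire_mult entire_const entire_coord)
    then show ?thesis by (simp add: l_def[abs_def] sum_divide_distrib mult.commute)
  qed
  have l_le: "norm (l w) \<le> norm w / norm z" for w
    using norm_hermitian_product_le[of w z] z0
    by (simp add: l_def norm_divide norm_power field_simps power2_eq_square norm_mult)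
  have "(\<lambda>N. (r / norm z) ^ N) \<longlonglongrightarrow> 0"
    using r R z0 by (intro LIMSEQ_realpow_zero) (simp_all add: divide_less_eq)
  then have "\<forall>\<^sub>F N in sequentially. (r / norm z) ^ N < 1/2"
    by (rule order_tendstoD) simp
  then obtain N where N: "(r / norm z) ^ N < 1/2"
    by (auto simp: eventually_sequentially)
  \<comment> \<open>The part of \<open>l ^ N\<close> that is not small, written as a combination of the \<open>w $ i - z $ i\<close> with coefficients \<open>q i\<close>.\<close>
  define u where "u w = of_real (\<kappa> w) * l w ^ N" for w
  define q where "q i w = u w * cnj (w $ i - z $ i) / of_real ((norm (w - z))\<^sup>2)" for i w
  define B where "B = S + norm z"
  define \<delta> where "\<delta> = 1 / (4 * (1 + real CARD('n) * B))"
  have B0: "0 \<le> B" using S(1) by (simp add: B_def)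
  have \<delta>0: "0 < \<delta>" using B0 by (simp add: \<delta>_def add_pos_nonneg)
  have "\<exists>g. entire g \<and> (\<forall>x\<in>Y. norm (g x - q i x) < \<delta>)" for i
  proof -
    have "continuous_on X (q i)"
      unfolding q_def u_def using zX
      by (intro continuous_intros continuous_on_subset[OF \<kappa>c] entire_continuous_on l_entire) auto
    moreover have "\<forall>x\<in>cball 0 R. q i x = 0"
      by (simp add: q_def u_def \<kappa>0)
    ultimately obtain g where "entire g" "\<And>x. x \<in> X \<inter> cball 0 S \<Longrightarrow> norm (g x - q i x) < \<delta>"
      using tail \<delta>0 unfolding tail_approximable_def by blast
    then show ?thesis using S(2) YX by (intro exI[of _ g]) auto
  qed
  then obtain g where g: "\<And>i. entire (g i)" "\<And>i x. x \<in> Y \<Longrightarrow> norm (g i x - q i x) < \<delta>"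
    by metis
  define H where "H w = l w ^ N - (\<Sum>i\<in>UNIV. (w $ i - z $ i) * g i w)" for w
  have H_entire: "entire H"
    unfolding H_def[abs_def]
    by (intro entire_diff entire_power l_entire entire_sum entire_mult entire_coord entire_const g)
  have "norm (H w) \<le> 3/4" if w: "w \<in> Y" for w
  proof -
    have "w \<noteq> z" using w zX YX by auto
    have "(\<Sum>i\<in>UNIV. (w $ i - z $ i) * q i w)
        = u w / of_real ((norm (w - z))\<^sup>2) * (\<Sum>i\<in>UNIV. (w - z) $ i * cnj ((w - z) $ i))"
      by (simp add: q_def sum_distrib_left mult_ac)
    also have "\<dots> = u w"
      using \<open>w \<noteq> z\<close> by (simp only: hermitian_product_self) simp
    finally have combination: "(\<Sum>i\<in>UNIV. (w $ i - z $ i) * q i w) = u w" .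
    have "(\<Sum>i\<in>UNIV. (w $ i - z $ i) * (g i w - q i w))
        = (\<Sum>i\<in>UNIV. (w $ i - z $ i) * g i w) - u w"
      by (simp only: right_diff_distrib sum_subtractf combination)
    then have eq: "H w = of_real (1 - \<kappa> w) * l w ^ N
        - (\<Sum>i\<in>UNIV. (w $ i - z $ i) * (g i w - q i w))"
      by (simp add: H_def u_def left_diff_distrib)
    have inner: "norm (of_real (1 - \<kappa> w) * l w ^ N) \<le> 1/2"
    proof (cases "norm w < r")
      case True
      have "norm (l w) ^ N \<le> (r / norm z) ^ N"
        using True z0 by (intro power_mono order_trans[OF l_le] divide_right_mono) auto
      then have "\<bar>1 - \<kappa> w\<bar> * norm (l w) ^ N \<le> 1 * (r / norm z) ^ N"
        using \<kappa>01[of w] by (intro mult_mono) auto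
      then show ?thesis using N by (simp only: norm_mult norm_of_real norm_power)
    next
      case False
      then show ?thesis using \<kappa>1[of w] by simp
    qed
    have "norm (\<Sum>i\<in>UNIV. (w $ i - z $ i) * (g i w - q i w)) \<le> (\<Sum>i\<in>(UNIV::'n set). B * \<delta>)"
    proof (rule sum_norm_le)
      fix i
      have "norm (w $ i - z $ i) \<le> norm (w - z)"
        using Finite_Cartesian_Product.norm_nth_le[of "w - z" i] by simp
      also have "\<dots> \<le> B"
        using norm_triangle_ineq4[of w z] S(2)[OF w] by (simp add: B_def)
      finally show "norm ((w $ i - z $ i) * (g i w - q i w)) \<le> B * \<delta>"
        unfolding norm_mult using g(2)[OF w, of i] B0 by (intro mult_mono) auto
    qed
    also have "(\<Sum>i\<in>(UNIV::'n set). B * \<delta>) \<le> 1/4"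
    proof -
      have "0 < 1 + real CARD('n) * B" using B0 by (simp add: add_pos_nonneg)
      then show ?thesis by (simp add: \<delta>_def divide_le_eq)
    qed
    finally have error: "norm (\<Sum>i\<in>UNIV. (w $ i - z $ i) * (g i w - q i w)) \<le> 1/4" .
    show ?thesis
      unfolding eq using add_mono[OF inner error] by (intro order_trans[OF norm_triangle_ineq4]) simp
  qed
  then have "norm (H z) \<le> 3/4"
    by (rule entire_poly_hull_le[OF zY Yb H_entire])
  then show False by (simp add: H_def lz)
qed

section \<open>The gliding hump\<close>

text \<open>
  The step of the gliding hump rests on the fact that the entire functions form a linear space: if
  \<open>\<phi>\<close> is not approximable, then \<open>F\<close> and \<open>F + d * \<phi>\<close> cannot both be close to entire functions for
  large \<open>d\<close>, since the difference of the two approximations would approximate \<open>d * \<phi>\<close>.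
\<close>

lemma carleman_imp_tail_approximable:
  fixes M K :: "(complex ^ 'n) set"
  assumes M: "carleman_approximation M" and K: "compact K"
  shows "\<exists>R\<ge>0. tail_approximable (K \<union> M) R"
proof (rule ccontr)
  assume none: "\<not> ?thesis"
  define X where "X = K \<union> M"
  obtain R0 where R0: "0 \<le> R0" "K \<subseteq> cball 0 R0"
    using compact_imp_bounded[OF K] bounded_pos by (metis less_imp_le mem_cball_0 subsetI)
  define bad where "bad R \<phi> S \<delta> \<longleftrightarrow> continuous_on X \<phi> \<and> (\<forall>x\<in>cball 0 R. \<phi> x = 0) \<and> 0 < \<delta> \<and>
      (\<forall>g. entire g \<longrightarrow> (\<exists>x\<in>X \<inter> cball 0 S. \<delta> \<le> norm (g x - \<phi> x)))" for R \<phi> S \<delta>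
  have "\<exists>\<phi> S \<delta>. bad R \<phi> S \<delta>" if "0 \<le> R" for R
  proof (rule ccontr)
    assume no_bad: "\<not> ?thesis"
    have "tail_approximable X R"
      unfolding tail_approximable_def
    proof (intro allI impI, rule ccontr)
      fix \<phi> S \<delta>
      assume "continuous_on X \<phi> \<and> (\<forall>x\<in>cball 0 R. \<phi> x = 0) \<and> 0 < \<delta>"
        and "\<not> (\<exists>g. entire g \<and> (\<forall>x\<in>X \<inter> cball 0 S. norm (g x - \<phi> x) < \<delta>))"
      then have "bad R \<phi> S \<delta>" unfolding bad_def by (meson not_less)
      then show False using no_bad by blast
    qed
    then show False using none that by (auto simp: X_def)
  qed
  then obtain \<phi> S \<delta> where \<phi>: "\<And>R. 0 \<le> R \<Longrightarrow> bad R (\<phi> R) (S R) (\<delta> R)"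
    by metis
  have bad: "continuous_on X (\<phi> R)" "norm x \<le> R \<Longrightarrow> \<phi> R x = 0" "0 < \<delta> R"
      "entire g \<Longrightarrow> \<exists>x\<in>X \<inter> cball 0 (S R). \<delta> R \<le> norm (g x - \<phi> R x)"
    if "0 \<le> R" for R x g
    using \<phi>[OF that] unfolding bad_def by auto
  \<comment> \<open>Consecutive radii: the failure of \<open>\<phi> (\<rho> k)\<close> is visible inside the ball of radius \<open>\<rho> (Suc k)\<close>, where all later summands vanish.\<close>
  define \<rho> where "\<rho> = rec_nat R0 (\<lambda>_ R. max (R + 1) (S R))"
  have \<rho>0: "\<rho> 0 = R0" and \<rho>S: "\<rho> (Suc k) = max (\<rho> k + 1) (S (\<rho> k))" for k
    by (simp_all add: \<rho>_def)
  have \<rho>_ge: "real k \<le> \<rho> k" for k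
    by (induction k) (use R0 in \<open>auto simp: \<rho>0 \<rho>S\<close>)
  then have \<rho>_nonneg: "0 \<le> \<rho> k" for k
    using order_trans[OF of_nat_0_le_iff] by blast
  have \<rho>_mono: "\<rho> i \<le> \<rho> j" if "i \<le> j" for i j
    by (rule lift_Suc_mono_le[OF _ that]) (simp add: \<rho>S)
  have "\<exists>c. \<forall>g. entire g \<longrightarrow> (\<exists>x\<in>X \<inter> cball 0 (S (\<rho> k)). real k \<le> norm (g x - (F x + c * \<phi> (\<rho> k) x)))"
    for k and F :: "complex ^ 'n \<Rightarrow> complex"
  proof (rule ccontr)
    assume "\<not> ?thesis"
    then have "\<exists>g. entire g \<and> (\<forall>x\<in>X \<inter> cball 0 (S (\<rho> k)). norm (g x - (F x + c * \<phi> (\<rho> k) x)) < real k)" for c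
      by (meson not_less)
    then obtain G where G: "\<And>c. entire (G c)"
      "\<And>c x. x \<in> X \<inter> cball 0 (S (\<rho> k)) \<Longrightarrow> norm (G c x - (F x + c * \<phi> (\<rho> k) x)) < real k"
      by metis
    \<comment> \<open>The functions \<open>G 0\<close> and \<open>G d\<close> approximate \<open>F\<close> and \<open>F + d * \<phi>\<close> up to \<open>k\<close>, so the quotient below approximates \<open>\<phi>\<close> up to \<open>2 * k / d\<close>.\<close>
    define d where "d = 2 * real (Suc k) / \<delta> (\<rho> k)"
    have d: "0 < d" using bad(3)[OF \<rho>_nonneg] by (simp add: d_def)
    let ?g = "\<lambda>x. of_real (1 / d) * (G (of_real d) x - G 0 x)"
    have "entire ?g"
      by (intro entire_mult entire_const entire_diff G)
    then obtain x where x: "x \<in> X \<inter> cball 0 (S (\<rho> k))" "\<delta> (\<rho> k) \<le> norm (?g x - \<phi> (\<rho> k) x)"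
      using bad(4)[OF \<rho>_nonneg] by blast
    have "?g x - \<phi> (\<rho> k) x = of_real (1 / d) *
        ((G (of_real d) x - (F x + of_real d * \<phi> (\<rho> k) x)) - (G 0 x - (F x + 0 * \<phi> (\<rho> k) x)))"
      using d by (simp add: field_simps)
    also have "norm \<dots> = 1 / d * norm ((G (of_real d) x - (F x + of_real d * \<phi> (\<rho> k) x)) - (G 0 x - (F x + 0 * \<phi> (\<rho> k) x)))"
      using d by (simp only: norm_mult norm_of_real) simp
    also have "\<dots> \<le> 1 / d * (real k + real k)"
      using d G(2)[OF x(1), of "of_real d"] G(2)[OF x(1), of 0]
      by (intro mult_left_mono order_trans[OF norm_triangle_ineq4] add_mono less_imp_le) auto
    also have "\<dots> < \<delta> (\<rho> k)"
      using bad(3)[OF \<rho>_nonneg, of k] by (simp add: d_def field_simps)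
    finally show False using x(2) by simp
  qed
  then obtain C where C: "\<And>k F g. entire g \<Longrightarrow>
      \<exists>x\<in>X \<inter> cball 0 (S (\<rho> k)). real k \<le> norm (g x - (F x + C k F * \<phi> (\<rho> k) x))"
    by metis
  define F where "F = rec_nat (\<lambda>_. 0) (\<lambda>k F x. F x + C k F * \<phi> (\<rho> k) x)"
  have F0: "F 0 = (\<lambda>_. 0)" and FS: "F (Suc k) = (\<lambda>x. F k x + C k (F k) * \<phi> (\<rho> k) x)" for k
    by (simp_all add: F_def)
  have F_cont: "continuous_on X (F k)" for k
    by (induction k) (auto simp: F0 FS intro!: continuous_intros bad(1) \<rho>_nonneg)
  have F_eq: "F j x = F k x" if "k \<le> j" "norm x \<le> \<rho> k" for j k x
    using that
  proof (induction j rule: dec_induct)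
    case (step j)
    then have "\<phi> (\<rho> j) x = 0"
      using \<rho>_mono[of k j] by (intro bad(2) \<rho>_nonneg) auto
    then show ?case using step by (simp add: FS)
  qed simp
  \<comment> \<open>The pointwise limit of the eventually constant sequence \<open>F k x\<close>; the index works because \<open>k \<le> \<rho> k\<close>.\<close>
  define f where "f x = F (nat \<lceil>norm x\<rceil>) x" for x
  have f_eq: "f x = F k x" if "norm x \<le> \<rho> k" for x k
  proof -
    let ?m = "nat \<lceil>norm x\<rceil>"
    have m: "norm x \<le> \<rho> ?m"
      using \<rho>_ge[of ?m] real_nat_ceiling_ge[of "norm x"] by linarith
    show ?thesis
      unfolding f_def using F_eq that m by (metis nat_le_linear)
  qed
  have "continuous (at x within M) f" if "x \<in> M" for x
  proof -
    obtain k where k: "norm x < \<rho> k"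
      using \<rho>_ge reals_Archimedean2[of "norm x"] by (meson order_less_le_trans)
    have "continuous (at x within M) (F k)"
      using continuous_on_subset[OF F_cont, of M k] that
      by (auto simp: X_def continuous_on_eq_continuous_within)
    then show ?thesis
    proof (rule continuous_transform_within)
      show "0 < \<rho> k - norm x" using k by simp
      show "F k x' = f x'" if "dist x' x < \<rho> k - norm x" for x'
        using that norm_triangle_ineq2[of x' x] by (intro f_eq[symmetric]) (simp add: dist_norm)
    qed (use that in auto)
  qed
  then have "continuous_on M f" by (simp add: continuous_on_eq_continuous_within)
  then obtain g where g: "entire g" "\<And>x. x \<in> M \<Longrightarrow> norm (g x - f x) < 1"
    using M[unfolded carleman_approximation_def, rule_format, of f "\<lambda>_. 1"] by auto
  have "bounded (g ` K)"
    by (intro compact_imp_bounded compact_continuous_image entire_continuous_on g K)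
  then obtain b where b: "\<And>x. x \<in> K \<Longrightarrow> norm (g x) \<le> b"
    by (auto simp: bounded_iff)
  obtain k where k: "max 1 b < real k" using reals_Archimedean2 by blast
  obtain x where x: "x \<in> X" "norm x \<le> S (\<rho> k)" "real k \<le> norm (g x - F (Suc k) x)"
    using C[OF g(1), of k "F k"] by (auto simp: FS)
  have "norm x \<le> \<rho> (Suc k)" using x(2) by (simp add: \<rho>S)
  then have far: "real k \<le> norm (g x - f x)" using x(3) by (simp add: f_eq)
  show False
  proof (cases "x \<in> M")
    case True
    then show ?thesis using g(2) far k by fastforce
  next
    case False
    then have "x \<in> K" using x(1) by (simp add: X_def)
    moreover from this have "f x = 0"
      using f_eq[of x 0] R0 by (auto simp: F0 \<rho>0)
    ultimately show ?thesis using b far k by fastforce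
  qed
qed

theorem theorem1p2:
  fixes M :: "(complex ^ 'n) set"
  assumes "closed M"
    and "carleman_approximation M"
  shows "bounded_E_hulls M"
  unfolding bounded_E_hulls_def
proof (intro allI impI)
  fix K :: "(complex ^ 'n) set"
  assume K: "compact K"
  then obtain R where R: "0 \<le> R" "tail_approximable (K \<union> M) R"
    using carleman_imp_tail_approximable assms(2) by blast
  have "closed (K \<union> M)"
    using K assms(1) by (simp add: closed_Un compact_imp_closed)
  then have "hull_excess (K \<union> M) \<subseteq> cball 0 R"
    using closed_hull_subset_if_tail_approximable[OF _ R(2,1)]
    by (force simp: hull_excess_def not_le[symmetric])
  then show "bounded (hull_excess (K \<union> M))"
    using bounded_cball bounded_subset by blast
qed

end
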